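(* Let $R$ be an mp-ring and let $I$ be a proper ideal of $R$. Then $$\bigcap_{\mathfrak{m}\in V(I)\cap \operatorname{Max}(R)} \sqrt{\operatorname{Ker}\pi_{\mathfrak{m}}}=\bigcap_{\substack{\mathfrak{m}\in V(I)\cap \operatorname{Max}(R) \\ \mathfrak{p}\in \Lambda(\mathfrak{m})\cap \operatorname{Min}(R) }} \mathfrak{p},$$ and this ideal, denoted $J$, is an N-pure ideal of $R$.
   Context: All rings are commutative with identity. A ring $R$ is an mp-ring if every prime ideal of $R$ contains a unique minimal prime ideal of $R$. $N(R)$ denotes the nilradical of $R$. An ideal $I$ of $R$ is called N-pure if for every $a\in I$ there exists $b\in I$ such that $a(1-b)\in N(R)$. $\operatorname{Max}(R)$ and $\operatorname{Min}(R)$ are the sets of maximal ideals and of minimal prime ideals of $R$, and $V(I)$ is the set of prime ideals of $R$ containing $I$. For a prime ideal $\mathfrak{p}$, $\Lambda(\mathfrak{p})$ is the set of all prime ideals $\mathfrak{q}$ of $R$ with $\mathfrak{q}\subseteq\mathfrak{p}$, and $\pi_{\mathfrak{p}}:R\to R_{\mathfrak{p}}=(R\setminus\mathfrak{p})^{-1}R$ denotes the natural localization homomorphism. $\sqrt{\cdot}$ denotes the radical of an ideal. *)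

theory Defs
  imports "HOL-Algebra.QuotRing"
begin

section \<open>Prime spectrum, minimal and maximal primes\<close>

definition Spec :: "('a, 'b) ring_scheme \<Rightarrow> 'a set set"
  where "Spec R = {\<pp>. primeideal \<pp> R}"

definition Max_Spec :: "('a, 'b) ring_scheme \<Rightarrow> 'a set set"
  where "Max_Spec R = {\<mm>. maximalideal \<mm> R}"

definition Min_Spec :: "('a, 'b) ring_scheme \<Rightarrow> 'a set set"
  where "Min_Spec R = {\<pp> \<in> Spec R. \<forall>\<qq> \<in> Spec R. \<qq> \<subseteq> \<pp> \<longrightarrow> \<qq> = \<pp>}"

definition V :: "('a, 'b) ring_scheme \<Rightarrow> 'a set \<Rightarrow> 'a set set"
  where "V R I = {\<pp> \<in> Spec R. I \<subseteq> \<pp>}"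

definition primes_below :: "('a, 'b) ring_scheme \<Rightarrow> 'a set \<Rightarrow> 'a set set"  (\<open>\<Lambda>\<index> _\<close> [90] 90)
  where "\<Lambda>\<^bsub>R\<^esub> \<pp> = {\<qq> \<in> Spec R. \<qq> \<subseteq> \<pp>}"

locale mp_ring = cring R for R (structure) +
  assumes unique_minimal_prime: "\<pp> \<in> Spec R \<Longrightarrow> \<exists>!\<qq>. \<qq> \<in> Min_Spec R \<and> \<qq> \<subseteq> \<pp>"


section \<open>Radicals and N-pure ideals\<close>

definition radical :: "('a, 'b) ring_scheme \<Rightarrow> 'a set \<Rightarrow> 'a set"
  where "radical R I = {a \<in> carrier R. \<exists>n::nat. 0 < n \<and> a [^]\<^bsub>R\<^esub> n \<in> I}"

definition nilradical :: "('a, 'b) ring_scheme \<Rightarrow> 'a set"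
  where "nilradical R = radical R {\<zero>\<^bsub>R\<^esub>}"

locale N_pure_ideal = ideal I R + cring R for I and R (structure) +
  assumes N_pure: "a \<in> I \<Longrightarrow> \<exists>b \<in> I. a \<otimes> (\<one> \<ominus> b) \<in> nilradical R"


section \<open>Localization\<close>

text \<open>
  The ring of fractions \<open>S\<inverse> R\<close>, for \<open>S\<close> a multiplicatively closed subset of a commutative
  ring \<open>R\<close>. Its elements are the classes of pairs \<open>(a, s)\<close> with \<open>a \<in> carrier R\<close> and \<open>s \<in> S\<close>.
  The factor \<open>u\<close> in the relation is needed because \<open>R\<close> may have zero divisors.
\<close>

definition frac_rel :: "('a, 'b) ring_scheme \<Rightarrow> 'a set \<Rightarrow> (('a \<times> 'a) \<times> ('a \<times> 'a)) set"
  where "frac_rel R S = {((a, s), (b, t)).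
    (a, s) \<in> carrier R \<times> S \<and> (b, t) \<in> carrier R \<times> S \<and>
    (\<exists>u \<in> S. u \<otimes>\<^bsub>R\<^esub> ((a \<otimes>\<^bsub>R\<^esub> t) \<ominus>\<^bsub>R\<^esub> (b \<otimes>\<^bsub>R\<^esub> s)) = \<zero>\<^bsub>R\<^esub>)}"

definition frac :: "('a, 'b) ring_scheme \<Rightarrow> 'a set \<Rightarrow> 'a \<Rightarrow> 'a \<Rightarrow> ('a \<times> 'a) set"
  where "frac R S a s = frac_rel R S `` {(a, s)}"

text \<open>
  The operations are defined on representatives; since the resulting class does not depend
  on the representatives, each union below is a union of copies of a single class.
\<close>

definition localization :: "('a, 'b) ring_scheme \<Rightarrow> 'a set \<Rightarrow> ('a \<times> 'a) set ring"
  where "localization R S =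
    \<lparr> carrier = (carrier R \<times> S) // frac_rel R S,
      mult = (\<lambda>X Y. \<Union>(a, s) \<in> X. \<Union>(b, t) \<in> Y.
        frac R S (a \<otimes>\<^bsub>R\<^esub> b) (s \<otimes>\<^bsub>R\<^esub> t)),
      one = frac R S \<one>\<^bsub>R\<^esub> \<one>\<^bsub>R\<^esub>,
      zero = frac R S \<zero>\<^bsub>R\<^esub> \<one>\<^bsub>R\<^esub>,
      add = (\<lambda>X Y. \<Union>(a, s) \<in> X. \<Union>(b, t) \<in> Y.
        frac R S ((a \<otimes>\<^bsub>R\<^esub> t) \<oplus>\<^bsub>R\<^esub> (b \<otimes>\<^bsub>R\<^esub> s)) (s \<otimes>\<^bsub>R\<^esub> t)) \<rparr>"

definition local_ring_at :: "('a, 'b) ring_scheme \<Rightarrow> 'a set \<Rightarrow> ('a \<times> 'a) set ring"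
  where "local_ring_at R \<pp> = localization R (carrier R - \<pp>)"

definition local_map :: "('a, 'b) ring_scheme \<Rightarrow> 'a set \<Rightarrow> 'a \<Rightarrow> ('a \<times> 'a) set"
  where "local_map R \<pp> a = frac R (carrier R - \<pp>) a \<one>\<^bsub>R\<^esub>"

definition ker_local_map :: "('a, 'b) ring_scheme \<Rightarrow> 'a set \<Rightarrow> 'a set"
  where "ker_local_map R \<pp> = a_kernel R (local_ring_at R \<pp>) (local_map R \<pp>)"

end

theory Submission
  imports Defs "HOL-Algebra.Ring_Divisibility"
begin

text \<open>
  An element \<open>a\<close> that lies in every prime ideal avoiding a multiplicative set \<open>S\<close> satisfies
  \<open>s a\<^sup>n = 0\<close> for some \<open>s \<in> S\<close>, since otherwise some prime would avoid all the products
  \<open>s a\<^sup>n\<close> (\<open>exists_primeideal_disjoint\<close>). For \<open>S = R - \<mm>\<close> this identifies the radical of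
  \<open>Ker \<pi>\<^sub>\<mm>\<close> with the intersection of the primes contained in \<open>\<mm>\<close>, for which the minimal ones
  suffice (\<open>radical_ker_local_map_eq\<close>). Intersecting over \<open>\<mm>\<close> gives the equation.

  For purity, let \<open>J\<close> be the intersection of all minimal primes below the maximal ideals containing
  \<open>I\<close>, and let \<open>a \<in> J\<close>. Some \<open>b \<in> J\<close> with \<open>a (1 - b)\<close> nilpotent exists unless the multiplicative
  set of all \<open>(1 - b) a\<^sup>n\<close> with \<open>b \<in> J\<close> misses \<open>0\<close>. In that case some prime \<open>\<qq>\<close> avoids this set,
  so that \<open>a \<notin> \<qq>\<close> and \<open>\<qq> + J\<close> lies in a maximal ideal \<open>\<mm>\<close>
  (\<open>annihilated_or_prime_disjoint\<close>). The same device, with \<open>I\<close> in place of \<open>J\<close> and \<open>R - \<mm>\<close> in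
  place of the powers of \<open>a\<close>, shows that \<open>J \<subseteq> \<mm>\<close> forces \<open>\<mm>\<close> to share a smaller prime with some
  maximal ideal \<open>\<mm>'\<close> containing \<open>I\<close>: otherwise \<open>(1 - i) t = 0\<close> with \<open>i \<in> I\<close> and \<open>t \<notin> \<mm>\<close>, and such a
  \<open>t\<close> lies in \<open>J\<close>, because \<open>1 - i\<close> lies in no maximal ideal containing \<open>I\<close>. In an mp-ring, \<open>\<mm>\<close>,
  \<open>\<mm>'\<close> and \<open>\<qq>\<close> then all contain the same minimal prime \<open>\<pp>\<close>. As \<open>\<pp>\<close> lies below \<open>\<mm>'\<close>, it
  contains \<open>J\<close> (\<open>generic_ideal_subset_minimal_prime\<close>), so \<open>a \<in> J \<subseteq> \<pp> \<subseteq> \<qq>\<close>, a contradiction.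
\<close>

section \<open>Prime ideals avoiding a multiplicative set\<close>

context cring
begin

lemma exists_maximal_disjoint_ideal:
  assumes "ideal I R" and "I \<inter> S = {}"
  shows "\<exists>P. ideal P R \<and> I \<subseteq> P \<and> P \<inter> S = {} \<and>
    (\<forall>K. ideal K R \<longrightarrow> P \<subseteq> K \<longrightarrow> K \<inter> S = {} \<longrightarrow> K = P)"
proof -
  let ?A = "{K. ideal K R \<and> I \<subseteq> K \<and> K \<inter> S = {}}"
  have "\<exists>P\<in>?A. \<forall>K\<in>?A. P \<subseteq> K \<longrightarrow> K = P"
  proof (rule subset_Zorn_nonempty)
    show "?A \<noteq> {}" using assms by blast
    fix C assume C: "C \<noteq> {}" "subset.chain ?A C"
    then have "subset.chain {K. ideal K R} C"
      by (auto simp: subset.chain_def)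
    then have "ideal (\<Union>C) R"
      using chain_Union_is_ideal[of C] C(1) by simp
    moreover have "I \<subseteq> \<Union>C" "\<Union>C \<inter> S = {}"
      using C unfolding subset.chain_def by blast+
    ultimately show "\<Union>C \<in> ?A" by blast
  qed
  then obtain P where P: "P \<in> ?A" and max: "\<forall>K\<in>?A. P \<subseteq> K \<longrightarrow> K = P" ..
  have "K = P" if "ideal K R" "P \<subseteq> K" "K \<inter> S = {}" for K
    using max that P by auto
  then show ?thesis using P by auto
qed

lemma exists_maximalideal_containing:
  assumes "ideal I R" and "I \<noteq> carrier R"
  obtains M where "maximalideal M R" "I \<subseteq> M"
proof -
  have "I \<inter> {\<one>} = {}" using assms ideal.one_imp_carrier by blast
  then obtain M where M: "ideal M R" "I \<subseteq> M" "M \<inter> {\<one>} = {}"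
    and max: "\<forall>K. ideal K R \<longrightarrow> M \<subseteq> K \<longrightarrow> K \<inter> {\<one>} = {} \<longrightarrow> K = M"
    using exists_maximal_disjoint_ideal[OF assms(1), of "{\<one>}"] by meson
  have "maximalideal M R"
  proof (rule maximalidealI)
    show "carrier R \<noteq> M" using M(3) by auto
    fix K assume "ideal K R" "M \<subseteq> K"
    then show "K = M \<or> K = carrier R"
      using max ideal.one_imp_carrier by blast
  qed (fact M)
  then show thesis using M(2) that by blast
qed

text \<open>
  An ideal that is maximal among those avoiding \<open>S\<close> is prime: if it contained \<open>a b\<close> but neither
  factor, then enlarging it by \<open>a\<close> and by \<open>b\<close> would produce two elements of \<open>S\<close> whose
  product lies in the ideal.
\<close>

lemma exists_primeideal_disjoint:
  assumes S: "S \<subseteq> carrier R" "\<one> \<in> S" "\<And>x y. x \<in> S \<Longrightarrow> y \<in> S \<Longrightarrow> x \<otimes> y \<in> S"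
    and "\<zero> \<notin> S"
  obtains P where "primeideal P R" "P \<inter> S = {}"
proof -
  have "{\<zero>} \<inter> S = {}" using \<open>\<zero> \<notin> S\<close> by blast
  then obtain P where P: "ideal P R" "{\<zero>} \<subseteq> P" "P \<inter> S = {}"
    and max: "\<forall>K. ideal K R \<longrightarrow> P \<subseteq> K \<longrightarrow> K \<inter> S = {} \<longrightarrow> K = P"
    using exists_maximal_disjoint_ideal[OF zeroideal, of S] by meson
  interpret P: ideal P R by (fact P)
  have hit: "\<exists>p\<in>P. \<exists>r\<in>carrier R. p \<oplus> r \<otimes> a \<in> S" if a: "a \<in> carrier R" "a \<notin> P" for a
  proof -
    let ?K = "set_add R P (PIdl a)"
    have sum: "?K = {p \<oplus> r \<otimes> a |p r. p \<in> P \<and> r \<in> carrier R}"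
      unfolding set_add_def' cgenideal_def by blast
    have "ideal ?K R"
      using P(1) a(1) cgenideal_ideal add_ideals by blast
    moreover have "P \<subseteq> ?K"
    proof
      fix p assume p: "p \<in> P"
      then have "p = p \<oplus> \<zero> \<otimes> a" using a(1) P.Icarr by simp
      then show "p \<in> ?K" unfolding sum using p by blast
    qed
    moreover have "a \<in> ?K"
    proof -
      have "a = \<zero> \<oplus> \<one> \<otimes> a" using a(1) by simp
      then show ?thesis unfolding sum using P.zero_closed by blast
    qed
    ultimately have "?K \<inter> S \<noteq> {}" using max a(2) by blast
    then show ?thesis unfolding sum by blast
  qed
  have "primeideal P R"
  proof (rule primeidealI)
    show "carrier R \<noteq> P" using S(2) P(3) by auto
    fix a b assume ab: "a \<in> carrier R" "b \<in> carrier R" "a \<otimes> b \<in> P"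
    show "a \<in> P \<or> b \<in> P"
    proof (rule ccontr)
      assume "\<not> (a \<in> P \<or> b \<in> P)"
      then obtain p r q s where
        pr: "p \<in> P" "r \<in> carrier R" "p \<oplus> r \<otimes> a \<in> S" and
        qs: "q \<in> P" "s \<in> carrier R" "q \<oplus> s \<otimes> b \<in> S"
        using hit ab(1,2) by meson
      have pq: "p \<in> carrier R" "q \<in> carrier R" using pr qs P.Icarr by auto
      have "(p \<oplus> r \<otimes> a) \<otimes> (q \<oplus> s \<otimes> b)
          = p \<otimes> (q \<oplus> s \<otimes> b) \<oplus> ((r \<otimes> a) \<otimes> q \<oplus> (r \<otimes> s) \<otimes> (a \<otimes> b))"
        using pq ab pr(2) qs(2) by algebra
      also have "\<dots> \<in> P"
      proof -
        have "p \<otimes> (q \<oplus> s \<otimes> b) \<in> P"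
          using P.I_r_closed[OF pr(1)] pq ab qs(2) by simp
        moreover have "(r \<otimes> a) \<otimes> q \<in> P"
          using P.I_l_closed[OF qs(1)] ab pr(2) by simp
        moreover have "(r \<otimes> s) \<otimes> (a \<otimes> b) \<in> P"
          using P.I_l_closed[OF ab(3)] pr(2) qs(2) by simp
        ultimately show ?thesis using P.a_closed by simp
      qed
      finally show False using S(3)[OF pr(3) qs(3)] P(3) by blast
    qed
  qed (fact P is_cring)+
  then show thesis using P(3) that by blast
qed

text \<open>
  The two alternatives correspond to whether \<open>0\<close> belongs to the multiplicative set of all
  \<open>(1 - i) t\<close> or not. A prime \<open>Q\<close> avoiding that set avoids \<open>T\<close>, and it avoids \<open>1 - I\<close>, which means that
  \<open>Q + I\<close> is proper.
\<close>

lemma annihilated_or_prime_disjoint: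
  assumes I: "ideal I R"
    and T: "T \<subseteq> carrier R" "\<one> \<in> T" "\<And>x y. x \<in> T \<Longrightarrow> y \<in> T \<Longrightarrow> x \<otimes> y \<in> T"
  obtains i t where "i \<in> I" "t \<in> T" "(\<one> \<ominus> i) \<otimes> t = \<zero>"
  | Q M where "primeideal Q R" "Q \<inter> T = {}" "maximalideal M R" "Q \<subseteq> M" "I \<subseteq> M"
proof (cases "\<exists>i\<in>I. \<exists>t\<in>T. (\<one> \<ominus> i) \<otimes> t = \<zero>")
  case True
  then show ?thesis using that(1) by blast
next
  case False
  interpret I: ideal I R by (fact I)
  let ?S = "{(\<one> \<ominus> i) \<otimes> t |i t. i \<in> I \<and> t \<in> T}"
  have unit: "x = (\<one> \<ominus> \<zero>) \<otimes> x" if "x \<in> carrier R" for x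
    using that by algebra
  have TS: "T \<subseteq> ?S"
    using unit T(1) I.zero_closed by blast
  have "\<exists>P. primeideal P R \<and> P \<inter> ?S = {}"
  proof (rule exists_primeideal_disjoint)
    show "?S \<subseteq> carrier R" using I.Icarr T(1) by auto
    show "\<one> \<in> ?S" using TS T(2) by blast
    show "\<zero> \<notin> ?S" using False by force
    fix x y assume "x \<in> ?S" "y \<in> ?S"
    then obtain i t j u where x: "i \<in> I" "t \<in> T" "x = (\<one> \<ominus> i) \<otimes> t"
      and y: "j \<in> I" "u \<in> T" "y = (\<one> \<ominus> j) \<otimes> u" by blast
    have car: "i \<in> carrier R" "j \<in> carrier R" "t \<in> carrier R" "u \<in> carrier R"
      using x y I.Icarr T(1) by auto
    have "x \<otimes> y = (\<one> \<ominus> (i \<oplus> (\<one> \<ominus> i) \<otimes> j)) \<otimes> (t \<otimes> u)"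
      unfolding x(3) y(3) using car by algebra
    moreover have "i \<oplus> (\<one> \<ominus> i) \<otimes> j \<in> I"
      using x(1) y(1) car by (intro I.a_closed I.I_l_closed) auto
    ultimately show "x \<otimes> y \<in> ?S" using T(3)[OF x(2) y(2)] by blast
  qed blast
  then obtain Q where Q: "primeideal Q R" "Q \<inter> ?S = {}" by blast
  interpret Q: primeideal Q R by (fact Q)
  let ?K = "set_add R Q I"
  have "\<one> \<notin> ?K"
  proof
    assume "\<one> \<in> ?K"
    then obtain x i where xi: "x \<in> Q" "i \<in> I" "\<one> = x \<oplus> i"
      unfolding set_add_def' by blast
    have car: "x \<in> carrier R" "i \<in> carrier R" using xi Q.Icarr I.Icarr by auto
    have "(\<one> \<ominus> i) \<otimes> \<one> = (x \<oplus> i) \<ominus> i"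
      using car by (simp flip: xi(3))
    also have "\<dots> = x" using car by algebra
    finally have "(\<one> \<ominus> i) \<otimes> \<one> = x" .
    then show False using xi(1,2) T(2) Q(2) by blast
  qed
  then have "?K \<noteq> carrier R" by auto
  then obtain M where M: "maximalideal M R" "?K \<subseteq> M"
    using exists_maximalideal_containing[OF add_ideals[OF Q.is_ideal I]] by blast
  have "Q \<subseteq> ?K"
    unfolding set_add_def' using Q.Icarr I.zero_closed r_zero by fastforce
  moreover have "I \<subseteq> ?K"
  proof
    fix i assume i: "i \<in> I"
    then have "i = \<zero> \<oplus> i" using I.Icarr by simp
    then show "i \<in> ?K" unfolding set_add_def' using i Q.zero_closed by blast
  qed
  moreover have "Q \<inter> T = {}" using Q(2) TS by blast
  ultimately show ?thesis using that(2) Q(1) M by blast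
qed

end

lemma (in primeideal) one_notin: "\<one> \<notin> I"
  using I_notcarr one_imp_carrier by blast

lemma (in primeideal) pow_in_imp_in:
  assumes "a \<in> carrier R" "a [^] (n::nat) \<in> I"
  shows "a \<in> I"
  using assms(2)
proof (induction n)
  case 0
  then show ?case using one_notin by simp
next
  case (Suc n)
  then show ?case using I_prime[of "a [^] n" a] assms(1) by auto
qed


section \<open>The kernel of a localization map\<close>

lemma (in cring) ker_local_map_eq:
  assumes "primeideal M R"
  shows "ker_local_map R M = {a \<in> carrier R. \<exists>s \<in> carrier R - M. s \<otimes> a = \<zero>}"
proof -
  interpret M: primeideal M R by (fact assms)
  let ?S = "carrier R - M"
  have S1: "\<one> \<in> ?S" using M.one_notin by simp
  have Sm: "s \<otimes> t \<in> ?S" if "s \<in> ?S" "t \<in> ?S" for s t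
    using that M.I_prime by auto
  have "Defs.frac R ?S a \<one> = Defs.frac R ?S \<zero> \<one> \<longleftrightarrow> (\<exists>s\<in>?S. s \<otimes> a = \<zero>)"
    if a: "a \<in> carrier R" for a
  proof
    assume "Defs.frac R ?S a \<one> = Defs.frac R ?S \<zero> \<one>"
    moreover have "(\<zero>, \<one>) \<in> Defs.frac R ?S \<zero> \<one>"
      using S1 by (auto simp: Defs.frac_def frac_rel_def a_minus_def)
    ultimately have "(\<zero>, \<one>) \<in> Defs.frac R ?S a \<one>" by simp
    then obtain u where u: "u \<in> ?S" "u \<otimes> (a \<otimes> \<one> \<ominus> \<zero> \<otimes> \<one>) = \<zero>"
      by (auto simp: Defs.frac_def frac_rel_def)
    moreover have "a \<otimes> \<one> \<ominus> \<zero> \<otimes> \<one> = a" using a by algebra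
    ultimately show "\<exists>s\<in>?S. s \<otimes> a = \<zero>" by auto
  next
    assume "\<exists>s\<in>?S. s \<otimes> a = \<zero>"
    then obtain s where s: "s \<in> ?S" "s \<otimes> a = \<zero>" by blast
    (* Multiplied by s, the numerators x t - b and y t - b agree; this is used for
       x, y = a, 0 and for x, y = 0, a. *)
    have shift: "(\<exists>u\<in>?S. u \<otimes> (x \<otimes> t \<ominus> b \<otimes> \<one>) = \<zero>)"
      if ex: "(\<exists>u\<in>?S. u \<otimes> (y \<otimes> t \<ominus> b \<otimes> \<one>) = \<zero>)"
        and car: "b \<in> carrier R" "t \<in> ?S" "x \<in> carrier R" "y \<in> carrier R"
        and xy: "s \<otimes> x = \<zero>" "s \<otimes> y = \<zero>" for b t x y
    proof -
      obtain u where u: "u \<in> ?S" "u \<otimes> (y \<otimes> t \<ominus> b \<otimes> \<one>) = \<zero>" using ex by blast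
      have car': "s \<in> carrier R" "t \<in> carrier R" "u \<in> carrier R" using s u car by auto
      have same: "(s \<otimes> u) \<otimes> (z \<otimes> t \<ominus> b \<otimes> \<one>) = \<ominus> (s \<otimes> u \<otimes> b)"
        if z: "z \<in> carrier R" "s \<otimes> z = \<zero>" for z
      proof -
        have "(s \<otimes> u) \<otimes> (z \<otimes> t \<ominus> b \<otimes> \<one>) = (u \<otimes> t) \<otimes> (s \<otimes> z) \<oplus> \<ominus> (s \<otimes> u \<otimes> b)"
          using car(1) car' z(1) by algebra
        then show ?thesis unfolding z(2) using car(1) car' by simp
      qed
      have "(s \<otimes> u) \<otimes> (x \<otimes> t \<ominus> b \<otimes> \<one>) = (s \<otimes> u) \<otimes> (y \<otimes> t \<ominus> b \<otimes> \<one>)"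
        using same car(3,4) xy by simp
      also have "\<dots> = s \<otimes> (u \<otimes> (y \<otimes> t \<ominus> b \<otimes> \<one>))"
        using car car' by (intro m_assoc) auto
      also have "\<dots> = \<zero>"
        unfolding u(2) using car' by simp
      finally show ?thesis using Sm[OF s(1) u(1)] by blast
    qed
    have s0: "s \<otimes> \<zero> = \<zero>" using s(1) by simp
    have mem: "(b, t) \<in> Defs.frac R ?S x \<one> \<longleftrightarrow>
        b \<in> carrier R \<and> t \<in> ?S \<and> (\<exists>u\<in>?S. u \<otimes> (x \<otimes> t \<ominus> b \<otimes> \<one>) = \<zero>)"
      if "x \<in> carrier R" for x b t
      using that S1 by (simp add: Defs.frac_def frac_rel_def)
    have "(b, t) \<in> Defs.frac R ?S a \<one> \<longleftrightarrow> (b, t) \<in> Defs.frac R ?S \<zero> \<one>" for b t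
      unfolding mem[OF a] mem[OF zero_closed]
      using shift[OF _ _ _ a zero_closed s(2) s0] shift[OF _ _ _ zero_closed a s0 s(2)] by blast
    then show "Defs.frac R ?S a \<one> = Defs.frac R ?S \<zero> \<one>" by auto
  qed
  then show ?thesis
    unfolding ker_local_map_def a_kernel_def' local_ring_at_def localization_def local_map_def
    by auto
qed


section \<open>Minimal primes below the maximal ideals that contain an ideal\<close>

text \<open>
  The minimal primes involved are the generic points of the spectrum that specialize to a closed
  point of \<open>V(I)\<close>; the ideal consists of the elements that vanish at all of them.
\<close>

definition generic_ideal :: "('a, 'b) ring_scheme \<Rightarrow> 'a set \<Rightarrow> 'a set"
  where "generic_ideal R I =
    (\<Inter>\<mm> \<in> V R I \<inter> Max_Spec R. \<Inter>\<pp> \<in> \<Lambda>\<^bsub>R\<^esub> \<mm> \<inter> Min_Spec R. \<pp>)"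

context mp_ring
begin

lemma obtain_minimal_prime_below:
  assumes "primeideal P R"
  obtains Q where "primeideal Q R" "Q \<in> Min_Spec R" "Q \<subseteq> P"
proof -
  have "P \<in> Spec R" using assms by (simp add: Spec_def)
  then obtain Q where Q: "Q \<in> Min_Spec R" "Q \<subseteq> P"
    using ex1_implies_ex[OF unique_minimal_prime] by blast
  then have "primeideal Q R" by (simp add: Min_Spec_def Spec_def)
  then show thesis using that Q by blast
qed

lemma minimal_prime_unique:
  assumes "primeideal P R" "Q \<in> Min_Spec R" "Q \<subseteq> P" "Q' \<in> Min_Spec R" "Q' \<subseteq> P"
  shows "Q = Q'"
proof -
  have "P \<in> Spec R" using assms(1) by (simp add: Spec_def)
  then show ?thesis using unique_minimal_prime assms(2-5) by auto
qed

text \<open>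
  If \<open>a\<close> lies in every minimal prime below \<open>M\<close>, it lies in every prime avoiding \<open>R - M\<close>.
  Hence no prime avoids the products of elements outside \<open>M\<close> with powers of \<open>a\<close>, and some such
  product vanishes.
\<close>

lemma radical_ker_local_map_eq:
  assumes "primeideal M R"
  shows "radical R (ker_local_map R M) = (\<Inter>\<pp> \<in> \<Lambda> M \<inter> Min_Spec R. \<pp>)"
proof
  interpret M: primeideal M R by (fact assms)
  show "radical R (ker_local_map R M) \<subseteq> (\<Inter>\<pp> \<in> \<Lambda> M \<inter> Min_Spec R. \<pp>)"
  proof
    fix a assume "a \<in> radical R (ker_local_map R M)"
    then obtain n :: nat and s where a: "a \<in> carrier R"
      and s: "s \<in> carrier R" "s \<notin> M" "s \<otimes> a [^] n = \<zero>"
      unfolding radical_def ker_local_map_eq[OF assms] by auto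
    have "a \<in> P" if P: "primeideal P R" "P \<subseteq> M" for P
    proof -
      interpret P: primeideal P R by (fact P)
      have "s \<otimes> a [^] n \<in> P" using s(3) by simp
      then have "a [^] n \<in> P" using P.I_prime s(1,2) a P(2) by blast
      then show ?thesis using P.pow_in_imp_in a by blast
    qed
    then show "a \<in> (\<Inter>\<pp> \<in> \<Lambda> M \<inter> Min_Spec R. \<pp>)"
      unfolding primes_below_def Spec_def by auto
  qed
  show "(\<Inter>\<pp> \<in> \<Lambda> M \<inter> Min_Spec R. \<pp>) \<subseteq> radical R (ker_local_map R M)"
  proof
    fix a assume "a \<in> (\<Inter>\<pp> \<in> \<Lambda> M \<inter> Min_Spec R. \<pp>)"
    then have min: "a \<in> P" if "primeideal P R" "P \<in> Min_Spec R" "P \<subseteq> M" for P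
      using that unfolding primes_below_def Spec_def by auto
    have below: "a \<in> P" if P: "primeideal P R" "P \<subseteq> M" for P
    proof -
      obtain Q where "primeideal Q R" "Q \<in> Min_Spec R" "Q \<subseteq> P"
        by (rule obtain_minimal_prime_below[OF P(1)])
      then show ?thesis using min P(2) by blast
    qed
    have a: "a \<in> carrier R"
      using below[OF assms] M.Icarr by blast
    let ?S = "{s \<otimes> a [^] (n::nat) |s n. s \<in> carrier R - M}"
    have "\<zero> \<in> ?S"
    proof (rule ccontr)
      assume "\<zero> \<notin> ?S"
      moreover have "?S \<subseteq> carrier R" using a by auto
      moreover have one: "\<one> \<in> ?S"
      proof -
        have "\<one> = \<one> \<otimes> a [^] (0::nat)" by simp
        then show ?thesis using M.one_notin by blast
      qed
      moreover have "x \<otimes> y \<in> ?S" if "x \<in> ?S" "y \<in> ?S" for x y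
      proof -
        obtain s t and m n :: nat where x: "s \<in> carrier R - M" "x = s \<otimes> a [^] m"
          and y: "t \<in> carrier R - M" "y = t \<otimes> a [^] n" using \<open>x \<in> ?S\<close> \<open>y \<in> ?S\<close> by blast
        have "x \<otimes> y = (s \<otimes> t) \<otimes> a [^] (m + n)"
          using x y a by (simp add: nat_pow_mult[symmetric] m_ac)
        moreover have "s \<otimes> t \<in> carrier R - M" using x y M.I_prime by auto
        ultimately show ?thesis by blast
      qed
      ultimately obtain P where P: "primeideal P R" "P \<inter> ?S = {}"
        using exists_primeideal_disjoint[of ?S] by blast
      interpret P: primeideal P R by (fact P)
      have "P \<subseteq> M"
      proof
        fix x assume x: "x \<in> P"
        have "x = x \<otimes> a [^] (0::nat)" using x P.Icarr by simp
        then show "x \<in> M" using x P.Icarr P(2) by blast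
      qed
      then have "a \<in> P" using below P(1) by blast
      moreover have "a = \<one> \<otimes> a [^] (1::nat)" using a by simp
      then have "a \<in> ?S" using M.one_notin by blast
      ultimately show False using P(2) by blast
    qed
    then obtain s and n :: nat where s: "s \<in> carrier R - M" "s \<otimes> a [^] n = \<zero>" by force
    (* A positive exponent is required, and n may be 0. *)
    have "s \<otimes> a [^] Suc n = (s \<otimes> a [^] n) \<otimes> a"
      using s(1) a by (simp add: m_assoc)
    then have "s \<otimes> a [^] Suc n = \<zero>" using s(2) a by simp
    then show "a \<in> radical R (ker_local_map R M)"
      unfolding radical_def ker_local_map_eq[OF assms] using s(1) a by blast
  qed
qed

lemma generic_ideal_ideal:
  assumes "ideal I R" and "I \<noteq> carrier R"
  shows "ideal (generic_ideal R I) R"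
proof -
  let ?C = "\<Union>\<mm> \<in> V R I \<inter> Max_Spec R. \<Lambda> \<mm> \<inter> Min_Spec R"
  obtain M where M: "maximalideal M R" "I \<subseteq> M"
    using exists_maximalideal_containing[OF assms] by blast
  have prime: "primeideal M R" using maximalideal_prime M(1) by blast
  obtain P where "primeideal P R" "P \<in> Min_Spec R" "P \<subseteq> M"
    using obtain_minimal_prime_below[OF prime] by blast
  with M prime have "?C \<noteq> {}"
    unfolding V_def Max_Spec_def Spec_def primes_below_def by blast
  moreover have "ideal P R" if "P \<in> ?C" for P
    using that primeideal.axioms(1) unfolding primes_below_def Spec_def by blast
  ultimately have "ideal (\<Inter>?C) R" using i_Intersect by blast
  moreover have "\<Inter>?C = generic_ideal R I" unfolding generic_ideal_def by blast
  ultimately show ?thesis by simp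
qed

text \<open>
  A prime \<open>M\<close> containing \<open>generic_ideal R I\<close> shares a smaller prime with some maximal ideal
  containing \<open>I\<close>: otherwise some \<open>t \<notin> M\<close> would be annihilated by an element of \<open>1 - I\<close>, which lies in
  none of these maximal ideals, and \<open>t\<close> would belong to \<open>generic_ideal R I\<close>. By uniqueness, the
  minimal prime below \<open>M\<close> is then one of those being intersected.
\<close>

lemma generic_ideal_subset_minimal_prime:
  assumes I: "ideal I R" and M: "primeideal M R" and sub: "generic_ideal R I \<subseteq> M"
    and P: "P \<in> Min_Spec R" "P \<subseteq> M"
  shows "generic_ideal R I \<subseteq> P"
proof -
  interpret I: ideal I R by (fact I)
  interpret M: primeideal M R by (fact M)
  have closed: "x \<otimes> y \<in> carrier R - M" if "x \<in> carrier R - M" "y \<in> carrier R - M" for x y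
    using that M.I_prime by auto
  have one: "\<one> \<in> carrier R - M" using M.one_notin by simp
  show ?thesis
  proof (rule annihilated_or_prime_disjoint[OF I Diff_subset one closed])
    fix i t assume it: "i \<in> I" "t \<in> carrier R - M" "(\<one> \<ominus> i) \<otimes> t = \<zero>"
    have car: "i \<in> carrier R" using it I.Icarr by blast
    have "t \<in> Q" if N: "maximalideal N R" "I \<subseteq> N" and Q: "primeideal Q R" "Q \<subseteq> N" for N Q
    proof -
      interpret N: primeideal N R using N(1) maximalideal_prime by blast
      interpret Q: primeideal Q R by (fact Q)
      have "\<one> \<ominus> i \<notin> N"
      proof
        assume "\<one> \<ominus> i \<in> N"
        then have "(\<one> \<ominus> i) \<oplus> i \<in> N" using it(1) N(2) by blast
        moreover have "(\<one> \<ominus> i) \<oplus> i = \<one>" using car by algebra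
        ultimately show False using N.one_notin by simp
      qed
      then have "\<one> \<ominus> i \<notin> Q" using Q(2) by blast
      moreover have "(\<one> \<ominus> i) \<otimes> t \<in> Q" using it(3) by simp
      ultimately show ?thesis using Q.I_prime[of "\<one> \<ominus> i" t] it(2) car by simp
    qed
    then have "t \<in> generic_ideal R I"
      unfolding generic_ideal_def V_def Max_Spec_def primes_below_def Spec_def by blast
    then show ?thesis using sub it(2) by blast
  next
    fix Q N
    assume Q: "primeideal Q R" "Q \<inter> (carrier R - M) = {}"
      and N: "maximalideal N R" "Q \<subseteq> N" "I \<subseteq> N"
    interpret Q: primeideal Q R by (fact Q)
    have "Q \<subseteq> M" using Q(2) Q.a_subset by blast
    obtain P' where P': "primeideal P' R" "P' \<in> Min_Spec R" "P' \<subseteq> Q"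
      using obtain_minimal_prime_below[OF Q(1)] by blast
    have "P' = P"
      using minimal_prime_unique[OF M] P' P \<open>Q \<subseteq> M\<close> by blast
    then have "P \<in> \<Lambda> N \<inter> Min_Spec R"
      using P' N(2) unfolding primes_below_def Spec_def by blast
    moreover have "N \<in> V R I \<inter> Max_Spec R"
      using N maximalideal_prime unfolding V_def Max_Spec_def Spec_def by blast
    ultimately show ?thesis unfolding generic_ideal_def by blast
  qed
qed

lemma generic_ideal_N_pure:
  assumes "ideal I R" and "I \<noteq> carrier R"
  shows "N_pure_ideal (generic_ideal R I) R"
proof -
  let ?J = "generic_ideal R I"
  interpret J: ideal ?J R by (rule generic_ideal_ideal[OF assms])
  have "\<exists>b\<in>?J. a \<otimes> (\<one> \<ominus> b) \<in> nilradical R" if a: "a \<in> ?J" for a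
  proof -
    have car: "a \<in> carrier R" using a J.Icarr by blast
    let ?T = "range (\<lambda>n::nat. a [^] n)"
    have T: "?T \<subseteq> carrier R" using car by auto
    have one: "\<one> \<in> ?T" using nat_pow_0[of a] by (metis rangeI)
    have closed: "x \<otimes> y \<in> ?T" if "x \<in> ?T" "y \<in> ?T" for x y
      using that car by (auto simp: nat_pow_mult)
    show ?thesis
    proof (rule annihilated_or_prime_disjoint[OF J.is_ideal T one closed])
      fix b t assume b: "b \<in> ?J" "t \<in> ?T" "(\<one> \<ominus> b) \<otimes> t = \<zero>"
      then obtain n :: nat where t: "t = a [^] n" by blast
      have bcar: "b \<in> carrier R" "\<one> \<ominus> b \<in> carrier R" using b(1) J.Icarr by auto
      have "(a \<otimes> (\<one> \<ominus> b)) [^] Suc n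
          = (a \<otimes> (\<one> \<ominus> b) [^] n) \<otimes> ((\<one> \<ominus> b) \<otimes> t)"
        unfolding t using car bcar by (simp add: nat_pow_distrib m_ac)
      then have "(a \<otimes> (\<one> \<ominus> b)) [^] Suc n = \<zero>" using b(3) car bcar by simp
      then have "a \<otimes> (\<one> \<ominus> b) \<in> nilradical R"
        unfolding nilradical_def radical_def using car bcar by blast
      then show ?thesis using b(1) by blast
    next
      fix Q M
      assume Q: "primeideal Q R" "Q \<inter> ?T = {}" and M: "maximalideal M R" "Q \<subseteq> M" "?J \<subseteq> M"
      obtain P where P: "P \<in> Min_Spec R" "P \<subseteq> Q"
        using obtain_minimal_prime_below[OF Q(1)] by blast
      have "?J \<subseteq> P"
        using generic_ideal_subset_minimal_prime[OF assms(1) maximalideal_prime[OF M(1)] M(3)]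
          P M(2) by blast
      then have "a \<in> Q" using a P(2) by blast
      moreover have "a \<in> ?T" using nat_pow_eone[OF car] by (metis rangeI)
      ultimately show ?thesis using Q(2) by blast
    qed
  qed
  then show ?thesis
    by (intro N_pure_ideal.intro N_pure_ideal_axioms.intro J.is_ideal is_cring)
qed

end

theorem theorem3p5:
  fixes R :: "('a, 'b) ring_scheme" (structure) and I :: "'a set"
  assumes "mp_ring R" and "ideal I R" and "I \<noteq> carrier R"
  shows "let J = (\<Inter>\<mm> \<in> V R I \<inter> Max_Spec R. \<Inter>\<pp> \<in> \<Lambda> \<mm> \<inter> Min_Spec R. \<pp>)
    in (\<Inter>\<mm> \<in> V R I \<inter> Max_Spec R. radical R (ker_local_map R \<mm>)) = J \<and> N_pure_ideal J R"
proof -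
  interpret mp_ring R by (fact assms)
  have "radical R (ker_local_map R \<mm>) = (\<Inter>\<pp> \<in> \<Lambda> \<mm> \<inter> Min_Spec R. \<pp>)"
    if "\<mm> \<in> V R I \<inter> Max_Spec R" for \<mm>
    using that radical_ker_local_map_eq unfolding V_def Spec_def by blast
  then have "(\<Inter>\<mm> \<in> V R I \<inter> Max_Spec R. radical R (ker_local_map R \<mm>)) = generic_ideal R I"
    unfolding generic_ideal_def by (intro INF_cong refl)
  then show ?thesis
    using generic_ideal_N_pure[OF assms(2,3)] unfolding Let_def generic_ideal_def by blast
qed

end
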